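(* If a graph $G$ is $(e)$-positive at a vertex $v$, then $G-v$ is $e$-positive.
   Context: All graphs are finite and simple. $G-v$ is the graph $G$ with vertex $v$ and all incident edges deleted (if $G$ has only the vertex $v$, take $X_{G-v}=1$). The chromatic symmetric function is $X_G=\sum_\kappa\prod_{u\in V(G)}x_{\kappa(u)}$ (commuting variables), summed over all proper colourings $\kappa:V(G)\to\mathbb Z_{>0}$. With $e_i=\sum_{j_1<\cdots<j_i}x_{j_1}\cdots x_{j_i}$ and $e_\lambda=\prod_i e_{\lambda_i}$, $G$ is $e$-positive if $X_G$ expands in the basis $\{e_\lambda\}$ of symmetric functions over $\mathbb Q$ with all coefficients nonnegative. A labelled graph on $d$ vertices is a graph with vertex set $[d]=\{1,\dots,d\}$. For a set partition $\pi$ of $[d]$, let $B_{\pi,i}$ be the block containing $i$, and let $e_\pi=\sum x_{i_1}\cdots x_{i_d}$ in noncommuting variables $x_1,x_2,\dots$, summed over all tuples $(i_1,\dots,i_d)$ of positive integers with $i_j\ne i_k$ whenever $j\neq k$ and $B_{\pi,j}=B_{\pi,k}$. The $e_\pi$, over set partitions $\pi$ of $[d]$, form a $\mathbb Q$-basis of $\mathrm{NCSym}^d$, the degree-$d$ part of the algebra of symmetric functions in noncommuting variables. For $d\ge 1$ let $\mathrm{type}(\pi)=(\lambda,b)$, where $b=|B_{\pi,d}|$ and $\lambda$ is the integer partition (possibly empty) formed by the sizes of the other blocks. $\mathrm{UBCSym}^d$ is the $\mathbb Q$-vector space with basis $\{e_{(\lambda,b)}\}$ over pairs of a partition $\lambda$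 and an integer $b\ge 1$ with $|\lambda|+b=d$, and $\nu:\mathrm{NCSym}^d\to\mathrm{UBCSym}^d$ is the linear map with $\nu(e_\pi)=e_{\mathrm{type}(\pi)}$. For a labelled graph $G$ on $d$ vertices, $Y_G=\sum_\kappa x_{\kappa(1)}\cdots x_{\kappa(d)}\in\mathrm{NCSym}^d$, summed over all proper colourings $\kappa:[d]\to\mathbb Z_{>0}$ of $G$, and $y_G=\nu(Y_G)$. For a graph $G$ on $d$ vertices with distinguished vertex $v$, $y_{G:v}=y_{G'}$ where $G'$ is any labelling of $G$ by $[d]$ in which $v$ has label $d$ (this does not depend on the choice of such labelling). $G$ is $(e)$-positive at $v$ if all coefficients of $y_{G:v}$ in the basis $\{e_{(\lambda,b)}\}$ are nonnegative. *)

theory Defs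
  imports Complex_Main "HOL-Library.Multiset" "HOL-Library.FuncSet"
    "HOL-Library.Disjoint_Sets" "HOL-Library.Poly_Mapping"
begin

definition simple_graph :: "'a set \<Rightarrow> 'a set set \<Rightarrow> bool" where
  "simple_graph V E \<longleftrightarrow> finite V \<and> (\<forall>e\<in>E. e \<subseteq> V \<and> card e = 2)"

text \<open>Colours, and likewise the indices of the variables, are the positive integers.\<close>

definition proper_colourings :: "'a set \<Rightarrow> 'a set set \<Rightarrow> ('a \<Rightarrow> nat) set" where
  "proper_colourings V E =
     {\<kappa> \<in> V \<rightarrow>\<^sub>E {0<..}. \<forall>u\<in>V. \<forall>w\<in>V. {u, w} \<in> E \<longrightarrow> \<kappa> u \<noteq> \<kappa> w}"

text \<open>A power series over the rationals in commuting variables is given by its coefficients;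
  the multiset \<open>m\<close> stands for the monomial that contains \<open>x\<^sub>j\<close> with exponent \<open>count m j\<close>.\<close>

type_synonym cseries = "nat multiset \<Rightarrow> rat"

definition cs_one :: cseries where
  "cs_one m = of_bool (m = {#})"

definition cs_mult :: "cseries \<Rightarrow> cseries \<Rightarrow> cseries" where
  "cs_mult f g m = (\<Sum>a | a \<subseteq># m. f a * g (m - a))"

definition elem_sym :: "nat \<Rightarrow> cseries" where
  "elem_sym i m = of_bool (\<exists>J. finite J \<and> J \<subseteq> {0<..} \<and> card J = i \<and> m = mset_set J)"

text \<open>Integer partitions are multisets of positive integers. Since \<open>cs_mult\<close> is associative and
  commutative, the fold does not depend on an order of the parts.\<close>

definition elem_sym_part :: "nat multiset \<Rightarrow> cseries" where
  "elem_sym_part p = fold_mset (\<lambda>i f. cs_mult (elem_sym i) f) cs_one p"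

text \<open>The coefficient of a monomial is the number of proper colourings that contribute it. For
  \<open>V = {}\<close> there is one (empty) colouring, so the series is \<open>cs_one\<close>.\<close>

definition chromatic_sym :: "'a set \<Rightarrow> 'a set set \<Rightarrow> cseries" where
  "chromatic_sym V E m =
     of_nat (card {\<kappa> \<in> proper_colourings V E. image_mset \<kappa> (mset_set V) = m})"

definition e_positive :: "'a set \<Rightarrow> 'a set set \<Rightarrow> bool" where
  "e_positive V E \<longleftrightarrow>
     (\<exists>c :: nat multiset \<Rightarrow>\<^sub>0 rat.
        (\<forall>p \<in> Poly_Mapping.keys c. 0 \<notin># p) \<and>
        chromatic_sym V E =
          (\<lambda>m. \<Sum>p \<in> Poly_Mapping.keys c. Poly_Mapping.lookup c p * elem_sym_part p m) \<and>
        (\<forall>p. 0 \<le> Poly_Mapping.lookup c p))"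

text \<open>A power series in noncommuting variables; the list \<open>[i\<^sub>1, \<dots>, i\<^sub>d]\<close> stands for the monomial
  \<open>x\<^bsub>i\<^sub>1\<^esub> \<dots> x\<^bsub>i\<^sub>d\<^esub>\<close>. Positions are counted from 1 in the mathematics and from 0 in lists.\<close>

type_synonym ncseries = "nat list \<Rightarrow> rat"

definition block :: "nat set set \<Rightarrow> nat \<Rightarrow> nat set" where
  "block \<pi> i = (THE B. B \<in> \<pi> \<and> i \<in> B)"

definition nc_elem :: "nat \<Rightarrow> nat set set \<Rightarrow> ncseries" where
  "nc_elem d \<pi> w = of_bool (length w = d \<and> set w \<subseteq> {0<..} \<and>
     (\<forall>j\<in>{1..d}. \<forall>k\<in>{1..d}. j \<noteq> k \<and> block \<pi> j = block \<pi> k \<longrightarrow> w ! (j - 1) \<noteq> w ! (k - 1)))"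

text \<open>Coordinates of an element of \<open>NCSym\<^sup>d\<close> in the basis \<open>e\<^sub>\<pi>\<close>. The choice is unique on
  \<open>NCSym\<^sup>d\<close> because the \<open>e\<^sub>\<pi>\<close> form a basis; outside \<open>NCSym\<^sup>d\<close> the value is irrelevant.\<close>

definition nc_coords :: "nat \<Rightarrow> ncseries \<Rightarrow> nat set set \<Rightarrow> rat" where
  "nc_coords d f = (SOME c. (\<forall>\<pi>. c \<pi> \<noteq> 0 \<longrightarrow> partition_on {1..d} \<pi>) \<and>
     f = (\<lambda>w. \<Sum>\<pi> | partition_on {1..d} \<pi>. c \<pi> * nc_elem d \<pi> w))"

definition part_type :: "nat \<Rightarrow> nat set set \<Rightarrow> nat multiset \<times> nat" where
  "part_type d \<pi> =
     (image_mset card (mset_set (\<pi> - {block \<pi> d})), card (block \<pi> d))"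

text \<open>\<open>UBCSym\<close> is the free vector space on the symbols \<open>e\<^bsub>(\<lambda>, b)\<^esub>\<close>: the coefficient of
  \<open>e\<^bsub>(\<lambda>, b)\<^esub>\<close> in \<open>y\<close> is \<open>Poly_Mapping.lookup y (\<lambda>, b)\<close>.\<close>

type_synonym ubcsym = "(nat multiset \<times> nat) \<Rightarrow>\<^sub>0 rat"

text \<open>The linear extension of \<open>e\<^sub>\<pi> \<mapsto> e\<^bsub>type(\<pi>)\<^esub>\<close>.\<close>

definition nu :: "nat \<Rightarrow> ncseries \<Rightarrow> ubcsym" where
  "nu d f = (\<Sum>\<pi> | partition_on {1..d} \<pi>.
     Poly_Mapping.single (part_type d \<pi>) (nc_coords d f \<pi>))"

text \<open>Labelled graphs on \<open>d\<close> vertices have vertex set \<open>{1..d}\<close>.\<close>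

definition nc_chromatic :: "nat \<Rightarrow> nat set set \<Rightarrow> ncseries" where
  "nc_chromatic d E w =
     of_nat (card {\<kappa> \<in> proper_colourings {1..d} E. map \<kappa> [1..<d + 1] = w})"

definition y_labelled :: "nat \<Rightarrow> nat set set \<Rightarrow> ubcsym" where
  "y_labelled d E = nu d (nc_chromatic d E)"

definition labelling_at :: "'a set \<Rightarrow> 'a \<Rightarrow> ('a \<Rightarrow> nat) \<Rightarrow> bool" where
  "labelling_at V v \<phi> \<longleftrightarrow> bij_betw \<phi> V {1..card V} \<and> \<phi> v = card V"

text \<open>The result does not depend on the labelling that is chosen.\<close>

definition y_pointed :: "'a set \<Rightarrow> 'a set set \<Rightarrow> 'a \<Rightarrow> ubcsym" where
  "y_pointed V E v =
     (let \<phi> = (SOME \<phi>. labelling_at V v \<phi>) in y_labelled (card V) ((\<lambda>e. \<phi> ` e) ` E))"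

definition e_positive_at :: "'a set \<Rightarrow> 'a set set \<Rightarrow> 'a \<Rightarrow> bool" where
  "e_positive_at V E v \<longleftrightarrow> (\<forall>p b. 0 \<le> Poly_Mapping.lookup (y_pointed V E v) (p, b))"

end

theory Submission imports Defs begin

text \<open>Write \<open>Y\<^sub>G = \<Sum>\<^sub>\<pi> c\<^sub>\<pi> e\<^sub>\<pi>\<close> with \<open>v\<close> labelled \<open>d\<close> and compare coefficients of the words in which the
  last letter occurs only once. On the left this leaves the proper colourings of \<open>G - v\<close>; on the
  right it turns \<open>e\<^sub>\<pi>\<close> into \<open>e\<^bsub>\<pi>'\<^esub>\<close>, where \<open>\<pi>'\<close> arises from \<open>\<pi>\<close> by deleting the point \<open>d\<close>. Letting the
  variables commute, \<open>e\<^bsub>\<pi>'\<^esub>\<close> becomes \<open>(\<Prod>\<^sub>i \<mu>\<^sub>i!) e\<^sub>\<mu>\<close>, where \<open>\<mu>\<close> is \<open>\<lambda>\<close> together with the part \<open>b - 1\<close> (if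
  \<open>b > 1\<close>) and \<open>(\<lambda>, b)\<close> is the type of \<open>\<pi>\<close>. Hence each coefficient of \<open>X\<^bsub>G-v\<^esub>\<close> is a nonnegative
  combination of coefficients of \<open>y\<^bsub>G:v\<^esub>\<close>. Linear independence of the \<open>e\<^sub>\<pi>\<close> is not needed, only
  that \<open>Y\<^sub>G\<close> lies in their span.\<close>

subsection \<open>The span of the elementary functions in noncommuting variables\<close>

text \<open>A word is viewed as the function from positions to letters, so that \<open>e_ind \<pi> f\<close> is the
  coefficient of the word \<open>f\<close> in \<open>e\<^sub>\<pi>\<close>.\<close>

definition e_ind :: "'a set set \<Rightarrow> ('a \<Rightarrow> 'b) \<Rightarrow> rat" where
  "e_ind \<pi> f = of_bool (\<forall>B\<in>\<pi>. inj_on f B)"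

text \<open>The set \<open>A\<close> of positions is arbitrary instead of \<open>{1..d}\<close>, so
  that span membership can be proved on parts of the positions and then combined.\<close>

definition e_span :: "'a set \<Rightarrow> (('a \<Rightarrow> 'b) \<Rightarrow> rat) set" where
  "e_span A = {F. \<exists>c. F = (\<lambda>f. \<Sum>\<pi> | partition_on A \<pi>. c \<pi> * e_ind \<pi> f)}"

lemma e_spanI: "(\<And>f. F f = (\<Sum>\<pi> | partition_on A \<pi>. c \<pi> * e_ind \<pi> f)) \<Longrightarrow> F \<in> e_span A"
  unfolding e_span_def by blast

lemma e_spanE:
  assumes "F \<in> e_span A"
  obtains c where "F = (\<lambda>f. \<Sum>\<pi> | partition_on A \<pi>. c \<pi> * e_ind \<pi> f)"
  using assms unfolding e_span_def by blast

lemma e_ind_in_e_span: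
  assumes "finite A" "partition_on A \<pi>"
  shows "e_ind \<pi> \<in> e_span A"
proof (rule e_spanI[where c = "\<lambda>\<sigma>. of_bool (\<sigma> = \<pi>)"])
  fix f :: "'a \<Rightarrow> 'b"
  have "finite {\<pi>. partition_on A \<pi>}"
    using assms by (simp add: finitely_many_partition_on)
  then show "e_ind \<pi> f = (\<Sum>\<sigma> | partition_on A \<sigma>. of_bool (\<sigma> = \<pi>) * e_ind \<sigma> f)"
    using assms by (simp add: of_bool_def if_distrib[where f = "\<lambda>x. x * _"] cong: if_cong)
qed

lemma e_span_scale:
  assumes "F \<in> e_span A"
  shows "(\<lambda>f. r * F f) \<in> e_span A"
proof -
  obtain c where "F = (\<lambda>f. \<Sum>\<pi> | partition_on A \<pi>. c \<pi> * e_ind \<pi> f)"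
    using assms by (rule e_spanE)
  then show ?thesis
    by (intro e_spanI[where c = "\<lambda>\<pi>. r * c \<pi>"]) (simp add: sum_distrib_left mult.assoc)
qed

lemma e_span_add:
  assumes "F \<in> e_span A" "G \<in> e_span A"
  shows "(\<lambda>f. F f + G f) \<in> e_span A"
proof -
  obtain c where "F = (\<lambda>f. \<Sum>\<pi> | partition_on A \<pi>. c \<pi> * e_ind \<pi> f)"
    using assms(1) by (rule e_spanE)
  moreover obtain d where "G = (\<lambda>f. \<Sum>\<pi> | partition_on A \<pi>. d \<pi> * e_ind \<pi> f)"
    using assms(2) by (rule e_spanE)
  ultimately show ?thesis
    by (intro e_spanI[where c = "\<lambda>\<pi>. c \<pi> + d \<pi>"]) (simp add: sum.distrib distrib_right)
qed

lemma e_span_diff: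
  assumes "F \<in> e_span A" "G \<in> e_span A"
  shows "(\<lambda>f. F f - G f) \<in> e_span A"
  using e_span_add[OF assms(1) e_span_scale[OF assms(2), of "-1"]] by simp

lemma e_span_sum:
  assumes "\<And>i. i \<in> I \<Longrightarrow> F i \<in> e_span A"
  shows "(\<lambda>f. \<Sum>i\<in>I. F i f) \<in> e_span A"
  using assms
proof (induction I rule: infinite_finite_induct)
  case (insert i I)
  then show ?case by (simp add: e_span_add)
qed (auto intro!: e_spanI[where c = "\<lambda>_. 0"])

text \<open>Partitions of \<open>A\<close> and \<open>B\<close> unite to a partition of
  \<open>A \<union> B\<close>, and injectivity on all blocks of the union is injectivity on both
  families. So products of the \<open>e_ind\<close> are again of this form.\<close>

lemma e_span_mult_disjoint:
  assumes "finite A" "finite B" "A \<inter> B = {}" and F: "F \<in> e_span A" and G: "G \<in> e_span B"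
  shows "(\<lambda>f. F f * G f) \<in> e_span (A \<union> B)"
proof -
  obtain c where c: "F = (\<lambda>f. \<Sum>\<pi> | partition_on A \<pi>. c \<pi> * e_ind \<pi> f)"
    using F by (rule e_spanE)
  obtain d where d: "G = (\<lambda>f. \<Sum>\<pi> | partition_on B \<pi>. d \<pi> * e_ind \<pi> f)"
    using G by (rule e_spanE)
  have eq: "F f * G f = (\<Sum>\<pi> | partition_on A \<pi>. \<Sum>\<sigma> | partition_on B \<sigma>. (c \<pi> * d \<sigma>) * e_ind (\<pi> \<union> \<sigma>) f)" for f
  proof -
    have "e_ind (\<pi> \<union> \<sigma>) f = e_ind \<pi> f * e_ind \<sigma> f" for \<pi> \<sigma>
      by (auto simp: e_ind_def)
    then show ?thesis
      unfolding c d by (simp add: sum_product mult_ac)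
  qed
  have "partition_on (A \<union> B) (\<pi> \<union> \<sigma>)" if "partition_on A \<pi>" "partition_on B \<sigma>" for \<pi> \<sigma>
    using that assms(3) by (auto simp: partition_on_def intro!: disjoint_union)
  then show ?thesis
    unfolding eq using assms(1,2)
    by (intro e_span_sum e_span_scale e_ind_in_e_span) auto
qed

lemma of_bool_inj_on_in_e_span:
  assumes "finite B"
  shows "(\<lambda>f. of_bool (inj_on f B)) \<in> e_span B"
proof (cases "B = {}")
  \<comment> \<open>Blocks are nonempty, so the only partition of the empty set is \<open>{}\<close>
    and not \<open>{B}\<close>.\<close>
  case True
  then show ?thesis
    using e_ind_in_e_span[of B "{}"] by (simp add: e_ind_def[abs_def] partition_on_empty)
next
  case False
  then show ?thesis
    using e_ind_in_e_span[of B "{B}"] assms by (simp add: e_ind_def[abs_def] partition_on_space)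
qed

section \<open>Power sums in noncommuting variables\<close>

text \<open>The indicator of \<open>const_on f S\<close> is the coefficient of the word
  \<open>f\<close> in the power sum of the single block \<open>S\<close>.\<close>

definition const_on :: "('a \<Rightarrow> 'b) \<Rightarrow> 'a set \<Rightarrow> bool" where
  "const_on f S \<longleftrightarrow> (\<forall>x\<in>S. \<forall>y\<in>S. f x = f y)"

text \<open>The Newton identity \<open>e\<^sub>n = \<Sum>\<^sub>k (-1)\<^sup>k\<^sup>-\<^sup>1 (k-1)! p\<^sub>k e\<^bsub>n-k\<^esub>\<close> in noncommuting variables:
  at a fixed \<open>f\<close> with \<open>T = {x \<in> B. f x = f a}\<close>, only \<open>S = T\<close> and the sets \<open>T - {x}\<close> contribute,
  and for \<open>|T| > 1\<close> they cancel.\<close>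

lemma newton_identity:
  fixes f :: "'a \<Rightarrow> 'b"
  assumes "finite B" "a \<in> B"
  shows "(of_bool (inj_on f B) :: rat) =
    (\<Sum>S | a \<in> S \<and> S \<subseteq> B. (-1) ^ (card S - 1) * fact (card S - 1) *
       (of_bool (const_on f S) * of_bool (inj_on f (B - S))))" (is "_ = sum ?h ?P")
proof -
  define T where "T = {x \<in> B. f x = f a}"
  have fT: "finite T" "a \<in> T" "T \<subseteq> B" using assms by (auto simp: T_def)
  have finP: "finite ?P" by (rule finite_subset[of _ "Pow B"]) (use assms in auto)
  have cT: "const_on f S \<longleftrightarrow> S \<subseteq> T" if "a \<in> S" "S \<subseteq> B" for S
  proof
    assume c: "const_on f S"
    have "f x = f a" if "x \<in> S" for x using c \<open>a \<in> S\<close> that unfolding const_on_def by blast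
    then show "S \<subseteq> T" using \<open>S \<subseteq> B\<close> by (auto simp: T_def)
  next
    assume "S \<subseteq> T"
    then have "f x = f a" if "x \<in> S" for x using that by (auto simp: T_def)
    then show "const_on f S" unfolding const_on_def by simp
  qed
  show ?thesis
  proof (cases "inj_on f (B - T)")
    \<comment> \<open>A collision outside \<open>T\<close> persists in \<open>B - S\<close> for
      every \<open>S \<subseteq> T\<close>, and any other \<open>S\<close> fails to be constant; so
      both sides vanish.\<close>
    case False
    have "?h S = 0" if "S \<in> ?P" for S
    proof (cases "S \<subseteq> T")
      case True
      then have "\<not> inj_on f (B - S)" using False by (meson Diff_mono inj_on_subset order_refl)
      then show ?thesis by simp
    qed (use cT that in auto)
    then have "sum ?h ?P = 0" by (intro sum.neutral) auto
    moreover have "\<not> inj_on f B" using False by (meson Diff_subset inj_on_subset)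
    ultimately show ?thesis by simp
  next
    case inj: True
    let ?Q = "insert T ((\<lambda>x. T - {x}) ` (T - {a}))"
    have "sum ?h ?P = sum ?h ?Q"
    proof (rule sum.mono_neutral_right[OF finP])
      show "?Q \<subseteq> ?P" using fT by auto
      show "\<forall>S\<in>?P - ?Q. ?h S = 0"
      proof
        fix S assume S: "S \<in> ?P - ?Q"
        show "?h S = 0"
        proof (rule ccontr)
          assume "?h S \<noteq> 0"
          then have c: "const_on f S" and i: "inj_on f (B - S)" by (auto split: if_splits)
          have "S \<subseteq> T" using c cT S by auto
          moreover have "S \<noteq> T" using S by auto
          ultimately obtain x where x: "x \<in> T" "x \<notin> S" by auto
          \<comment> \<open>Two elements of \<open>T\<close> missing from \<open>S\<close> would
            share a colour inside \<open>B - S\<close>.\<close>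
          have "S = T - {x}"
          proof (rule ccontr)
            assume "S \<noteq> T - {x}"
            then obtain y where "y \<in> T" "y \<notin> S" "y \<noteq> x" using x \<open>S \<subseteq> T\<close> by auto
            then show False using x i by (auto simp: T_def inj_on_def)
          qed
          moreover have "x \<noteq> a" using x S by auto
          ultimately show False using S x by auto
        qed
      qed
    qed
    also have "\<dots> = ?h T + (\<Sum>x\<in>T - {a}. ?h (T - {x}))"
    proof (subst sum.insert)
      show "?h T + sum ?h ((\<lambda>x. T - {x}) ` (T - {a})) = ?h T + (\<Sum>x\<in>T - {a}. ?h (T - {x}))"
        by (subst sum.reindex) (auto simp: inj_on_def)
    qed (use fT in auto)
    also have "?h T = (-1) ^ (card T - 1) * fact (card T - 1)"
      using cT[of T] fT inj by simp
    also have "(\<Sum>x\<in>T - {a}. ?h (T - {x})) =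
        (\<Sum>x\<in>T - {a}. (-1) ^ (card T - 1 - 1) * fact (card T - 1 - 1))"
    proof (rule sum.cong)
      fix x assume x: "x \<in> T - {a}"
      then have "const_on f (T - {x})" using cT[of "T - {x}"] fT by auto
      moreover have "inj_on f (B - (T - {x}))"
      proof -
        have "B - (T - {x}) = insert x (B - T)" using x fT by auto
        moreover have "f x \<notin> f ` (B - T)" using x by (auto simp: T_def)
        ultimately show ?thesis using inj by (auto simp: inj_on_insert)
      qed
      ultimately show "?h (T - {x}) = (-1) ^ (card T - 1 - 1) * fact (card T - 1 - 1)"
        using x fT by simp
    qed simp
    also have "\<dots> = of_nat (card T - 1) * ((-1) ^ (card T - 1 - 1) * fact (card T - 1 - 1))"
      using fT by simp
    \<comment> \<open>For \<open>card T = k + 2\<close> the summands are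
      \<open>(-1)^(k+1) (k+1)!\<close> and \<open>(k+1) (-1)^k k!\<close>, which cancel; for
      \<open>card T = 1\<close> they are 1 and 0.\<close>
    also have "(-1) ^ (card T - 1) * fact (card T - 1) + \<dots> = (of_bool (card T = 1) :: rat)"
    proof -
      have "card T > 0" using fT by (auto simp: card_gt_0_iff)
      then consider "card T = 1" | k where "card T = Suc (Suc k)"
        by (metis One_nat_def gr0_implies_Suc not0_implies_Suc)
      then show ?thesis by cases (auto simp: algebra_simps)
    qed
    also have "card T = 1 \<longleftrightarrow> inj_on f B"
    proof
      assume "card T = 1"
      then have "T = {a}" using fT by (auto simp: card_1_singleton_iff)
      then have B: "insert a (B - T) = B" using \<open>a \<in> B\<close> by blast
      have "f a \<notin> f ` (B - T)" unfolding T_def by force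
      then have "inj_on f (insert a (B - T))" using inj by (subst inj_on_insert) blast
      then show "inj_on f B" unfolding B .
    next
      assume "inj_on f B"
      then have "x = a" if "x \<in> T" for x using that assms(2) unfolding T_def inj_on_def by blast
      then have "T = {a}" using fT(2) by blast
      then show "card T = 1" by simp
    qed
    finally show ?thesis by simp
  qed
qed

text \<open>Solve the Newton identity for its term \<open>S = B\<close>, whose coefficient is a
  nonzero signed factorial. The other terms are products of constancy on a proper subset
  \<open>S\<close>, covered by induction, and injectivity on \<open>B - S\<close>.\<close>

lemma of_bool_const_on_in_e_span:
  assumes "finite B"
  shows "(\<lambda>f :: 'a \<Rightarrow> 'b. of_bool (const_on f B)) \<in> e_span B"
  using assms
proof (induction B rule: finite_psubset_induct)
  case (psubset B)
  show ?case
  proof (cases "B = {}")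
    case True
    then show ?thesis
      using e_ind_in_e_span[of B "{}"]
      by (simp add: e_ind_def[abs_def] partition_on_empty const_on_def)
  next
    case False
    then obtain a where a: "a \<in> B" by auto
    let ?h = "\<lambda>S. (-1) ^ (card S - 1) * fact (card S - 1) :: rat"
    let ?t = "\<lambda>S f. of_bool (const_on (f :: 'a \<Rightarrow> 'b) S) * of_bool (inj_on f (B - S)) :: rat"
    let ?P = "{S. a \<in> S \<and> S \<subset> B}"
    have finP: "finite ?P" by (rule finite_subset[of _ "Pow B"]) (use psubset in auto)
    have P: "{S. a \<in> S \<and> S \<subseteq> B} = insert B ?P" using a by auto
    have "of_bool (inj_on f B) = ?h B * of_bool (const_on f B) + (\<Sum>S\<in>?P. ?h S * ?t S f)" for f
      using finP unfolding newton_identity[OF \<open>finite B\<close> a] P by (subst sum.insert) auto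
    moreover have "?h B \<noteq> 0" by simp
    ultimately have eq: "of_bool (const_on f B) =
        (1 / ?h B) * (of_bool (inj_on f B) - (\<Sum>S\<in>?P. ?h S * ?t S f))" for f
      by (simp add: field_simps)
    have "?t S \<in> e_span B" if "S \<in> ?P" for S
    proof -
      have "finite S" using that psubset(1) by (auto intro: finite_subset)
      then have "?t S \<in> e_span (S \<union> (B - S))"
        using that psubset
        by (intro e_span_mult_disjoint of_bool_inj_on_in_e_span) auto
      also have "S \<union> (B - S) = B" using that by auto
      finally show ?thesis .
    qed
    then show ?thesis
      unfolding eq using psubset(1)
      by (intro e_span_scale e_span_diff e_span_sum of_bool_inj_on_in_e_span) auto
  qed
qed

text \<open>The power sum of a partition is the product of the power sums of its blocks, which live
  on disjoint sets of positions.\<close>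

lemma of_bool_const_on_blocks_in_e_span:
  assumes "finite A" "partition_on A \<pi>"
  shows "(\<lambda>f. of_bool (\<forall>B\<in>\<pi>. const_on f B)) \<in> e_span A"
proof -
  have "finite \<pi>" using assms by (rule finite_elements)
  moreover have "disjoint \<pi>" "finite (\<Union>\<pi>)"
    using assms by (auto simp: partition_on_def)
  ultimately have "(\<lambda>f. of_bool (\<forall>B\<in>\<pi>. const_on f B)) \<in> e_span (\<Union>\<pi>)"
  proof (induction \<pi> rule: finite_induct)
    case empty
    then show ?case
      using e_ind_in_e_span[of "{}" "{}"] by (simp add: e_ind_def[abs_def] partition_on_empty)
  next
    case (insert B \<pi>)
    have "B \<inter> \<Union>\<pi> = {}"
      using insert.hyps insert.prems by (auto simp: pairwise_insert disjnt_def)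
    then show ?case
      using insert by (auto simp: pairwise_insert of_bool_conj
          intro!: e_span_mult_disjoint of_bool_const_on_in_e_span)
  qed
  then show ?thesis using assms by (simp add: partition_on_def)
qed

text \<open>The equations in \<open>R\<close> force equality along an equivalence relation on
  \<open>A\<close>; satisfying them means being constant on its classes, so the indicator is a power
  sum.\<close>

lemma of_bool_eqs_in_e_span:
  assumes "finite A" "R \<subseteq> A \<times> A"
  shows "(\<lambda>f :: 'a \<Rightarrow> 'b. of_bool (\<forall>(x, y)\<in>R. f x = f y)) \<in> e_span A"
proof -
  \<comment> \<open>Relating the pairs on which all solutions agree gives an equivalence that
    visibly contains \<open>R\<close>.\<close>
  define K where "K = {(x, y) \<in> A \<times> A. \<forall>f :: 'a \<Rightarrow> 'b. (\<forall>(x, y)\<in>R. f x = f y) \<longrightarrow> f x = f y}"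
  have K: "equiv A K"
    by (rule equivI) (auto simp: K_def refl_on_def sym_def trans_def)
  have "(\<forall>(x, y)\<in>R. f x = f y) \<longleftrightarrow> (\<forall>B\<in>A // K. const_on f B)" for f :: "'a \<Rightarrow> 'b"
  proof
    assume f: "\<forall>(x, y)\<in>R. f x = f y"
    have "f x = f y" if "(x, y) \<in> K" for x y
      using that f by (auto simp: K_def)
    then show "\<forall>B\<in>A // K. const_on f B"
      unfolding const_on_def by (metis K quotient_eq_iff)
  next
    assume f: "\<forall>B\<in>A // K. const_on f B"
    show "\<forall>(x, y)\<in>R. f x = f y"
    proof clarify
      fix x y assume xy: "(x, y) \<in> R"
      then have "(x, y) \<in> K" "x \<in> A" using assms by (auto simp: K_def)
      then have "x \<in> K `` {x}" "y \<in> K `` {x}" "K `` {x} \<in> A // K"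
        using equiv_class_self[OF K] by (simp_all add: quotientI)
      then show "f x = f y" using f unfolding const_on_def by blast
    qed
  qed
  then show ?thesis
    using of_bool_const_on_blocks_in_e_span[OF assms(1) partition_on_quotient[OF K]] by simp
qed

text \<open>Deletion--contraction on the set \<open>D\<close> of forbidden coincidences.\<close>

lemma of_bool_eqs_neqs_in_e_span:
  assumes "finite A" "finite D" "D \<subseteq> A \<times> A" "R \<subseteq> A \<times> A"
  shows "(\<lambda>f :: 'a \<Rightarrow> 'b. of_bool ((\<forall>(x, y)\<in>R. f x = f y) \<and> (\<forall>(x, y)\<in>D. f x \<noteq> f y))) \<in> e_span A"
  using assms(2-4)
proof (induction D arbitrary: R rule: finite_induct)
  case empty
  then show ?case using of_bool_eqs_in_e_span[OF assms(1)] by simp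
next
  case (insert p D)
  let ?I = "\<lambda>R D f. of_bool ((\<forall>(x, y)\<in>R. (f :: 'a \<Rightarrow> 'b) x = f y) \<and> (\<forall>(x, y)\<in>D. f x \<noteq> f y)) :: rat"
  obtain x y where p: "p = (x, y)" by force
  \<comment> \<open>The functions separating \<open>p\<close> are all those with \<open>p\<close>
    left free, minus those with \<open>p\<close> moved to the equations. This is why
    \<open>R\<close> varies in the induction.\<close>
  have "?I R (insert p D) = (\<lambda>f. ?I R D f - ?I (insert p R) D f)"
    by (auto simp: p fun_eq_iff)
  also have "\<dots> \<in> e_span A"
    using insert by (intro e_span_diff insert.IH) auto
  finally show ?case .
qed

subsection \<open>Products of elementary symmetric functions as generating functions\<close>

lemma finite_submultisets: "finite {a. a \<subseteq># (m :: 'a multiset)}"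
proof (rule finite_subset)
  show "{a. a \<subseteq># m} \<subseteq> (\<Union>n\<le>size m. multisets_of_size (set_mset m) n)"
    by (auto simp: multisets_of_size_def size_mset_mono dest: mset_subset_eqD)
qed auto

text \<open>Both sides sum \<open>f a * g b * h (m - a - b)\<close> over the pairs with
  \<open>a + b \<subseteq># m\<close>, a condition symmetric in \<open>a\<close> and
  \<open>b\<close>. The fold in \<open>elem_sym_part\<close> relies on this law.\<close>

lemma cs_mult_left_commute: "cs_mult f (cs_mult g h) = cs_mult g (cs_mult f h)"
proof
  fix m
  have expand: "cs_mult f (cs_mult g h) m =
      (\<Sum>(a, b) \<in> Sigma {a. a \<subseteq># m} (\<lambda>a. {b. b \<subseteq># m - a}). f a * (g b * h (m - a - b)))" for f g
    unfolding cs_mult_def sum_distrib_left by (subst sum.Sigma) (auto simp: finite_submultisets)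
  have "a \<subseteq># m \<and> b \<subseteq># m - a \<longleftrightarrow> a + b \<subseteq># m" for a b
    unfolding subseteq_mset_def all_conj_distrib[symmetric] by (intro all_cong1) auto
  then have "Sigma {a. a \<subseteq># m} (\<lambda>a. {b. b \<subseteq># m - a}) = {(a, b). a + b \<subseteq># m}"
    by auto
  then show "cs_mult f (cs_mult g h) m = cs_mult g (cs_mult f h) m"
    unfolding expand
    by (intro sum.reindex_bij_witness[where i = "\<lambda>(a, b). (b, a)" and j = "\<lambda>(a, b). (b, a)"])
       (auto simp: add.commute mult_ac)
qed

lemma elem_sym_part_empty [simp]: "elem_sym_part {#} = cs_one"
  by (simp add: elem_sym_part_def)

lemma elem_sym_part_add_mset [simp]:
  "elem_sym_part (add_mset i p) = cs_mult (elem_sym i) (elem_sym_part p)"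
proof -
  interpret comp_fun_commute "\<lambda>i. cs_mult (elem_sym i)"
    by standard (rule ext, unfold o_apply, rule cs_mult_left_commute)
  show ?thesis by (simp add: elem_sym_part_def)
qed

section \<open>Letting the variables commute\<close>

definition colourings_with_content :: "'a set \<Rightarrow> nat multiset \<Rightarrow> ('a \<Rightarrow> nat) set" where
  "colourings_with_content A m = {\<kappa> \<in> A \<rightarrow>\<^sub>E {0<..}. image_mset \<kappa> (mset_set A) = m}"

text \<open>This is the commutative image of the series with word coefficients \<open>F\<close>: all
  words with the same multiset of letters are collected.\<close>

definition content_sum :: "'a set \<Rightarrow> (('a \<Rightarrow> nat) \<Rightarrow> rat) \<Rightarrow> cseries" where
  "content_sum A F m = (\<Sum>\<kappa>\<in>colourings_with_content A m. F \<kappa>)"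

lemma finite_colourings_with_content:
  assumes "finite A"
  shows "finite (colourings_with_content A m)"
proof (rule finite_subset)
  show "colourings_with_content A m \<subseteq> A \<rightarrow>\<^sub>E set_mset m"
    using assms by (auto simp: colourings_with_content_def PiE_iff intro: extensional_arb)
qed (use assms in \<open>auto intro: finite_PiE\<close>)

lemma content_sum_of_bool:
  assumes "finite A"
  shows "content_sum A (\<lambda>\<kappa>. of_bool (P \<kappa>)) m =
    of_nat (card {\<kappa> \<in> colourings_with_content A m. P \<kappa>})"
  using finite_colourings_with_content[OF assms, of m]
  by (simp add: content_sum_def of_bool_def sum.If_cases Int_def)

lemma chromatic_sym_eq_content_sum:
  assumes "finite V"
  shows "chromatic_sym V E = content_sum V (\<lambda>\<kappa>. of_bool (\<kappa> \<in> proper_colourings V E))"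
proof
  fix m
  have "{\<kappa> \<in> proper_colourings V E. image_mset \<kappa> (mset_set V) = m} =
      {\<kappa> \<in> colourings_with_content V m. \<kappa> \<in> proper_colourings V E}"
    by (auto simp: colourings_with_content_def proper_colourings_def)
  then show "chromatic_sym V E m = content_sum V (\<lambda>\<kappa>. of_bool (\<kappa> \<in> proper_colourings V E)) m"
    using assms by (simp add: content_sum_of_bool chromatic_sym_def)
qed

text \<open>A colouring of \<open>A \<union> B\<close> is a pair of colourings, and contents add up.
  The restrictions hand \<open>F\<close> and \<open>G\<close> the extensional functions over which
  their own content sums range.\<close>

lemma content_sum_Un_disjoint:
  assumes "finite A" "finite B" "A \<inter> B = {}"
  shows "content_sum (A \<union> B) (\<lambda>\<kappa>. F (restrict \<kappa> A) * G (restrict \<kappa> B)) =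
    cs_mult (content_sum A F) (content_sum B G)"
proof
  fix m
  let ?C = "colourings_with_content"
  \<comment> \<open>Outside \<open>A \<union> B\<close> the glued map takes the value of
    \<open>\<kappa>'\<close>, which is \<open>undefined\<close> there, so it stays
    extensional.\<close>
  let ?join = "\<lambda>\<kappa> \<kappa>' x. if x \<in> A then \<kappa> x else \<kappa>' x :: nat"
  have restr: "image_mset (restrict \<kappa> S) (mset_set S) = image_mset \<kappa> (mset_set S)" for \<kappa> :: "'a \<Rightarrow> nat" and S
    by (cases "finite S") (auto intro!: image_mset_cong)
  have content_Un: "image_mset \<kappa> (mset_set (A \<union> B)) =
      image_mset \<kappa> (mset_set A) + image_mset \<kappa> (mset_set B)" for \<kappa> :: "'a \<Rightarrow> nat"
    using assms by (simp add: mset_set_Union)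
  have join: "restrict (?join \<kappa> \<kappa>') A = \<kappa>" "restrict (?join \<kappa> \<kappa>') B = \<kappa>'"
      "image_mset (?join \<kappa> \<kappa>') (mset_set A) = a" "image_mset (?join \<kappa> \<kappa>') (mset_set B) = b"
      "?join \<kappa> \<kappa>' \<in> (A \<union> B) \<rightarrow>\<^sub>E {0<..}"
    if "\<kappa> \<in> ?C A a" "\<kappa>' \<in> ?C B b" for \<kappa> \<kappa>' a b
  proof -
    have ext: "\<kappa> \<in> extensional A" "\<kappa>' \<in> extensional B"
      using that by (auto simp: colourings_with_content_def PiE_iff)
    have "restrict (?join \<kappa> \<kappa>') A = restrict \<kappa> A" "restrict (?join \<kappa> \<kappa>') B = restrict \<kappa>' B"
      using assms(3) by (auto intro!: restrict_ext)
    then show A: "restrict (?join \<kappa> \<kappa>') A = \<kappa>" and B: "restrict (?join \<kappa> \<kappa>') B = \<kappa>'"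
      by (simp_all only: extensional_restrict ext)
    show "image_mset (?join \<kappa> \<kappa>') (mset_set A) = a"
      using that(1) restr[of "?join \<kappa> \<kappa>'" A] unfolding A by (simp add: colourings_with_content_def)
    show "image_mset (?join \<kappa> \<kappa>') (mset_set B) = b"
      using that(2) restr[of "?join \<kappa> \<kappa>'" B] unfolding B by (simp add: colourings_with_content_def)
    show "?join \<kappa> \<kappa>' \<in> (A \<union> B) \<rightarrow>\<^sub>E {0<..}"
      using that by (auto simp: colourings_with_content_def PiE_iff extensional_def)
  qed
  have "cs_mult (content_sum A F) (content_sum B G) m =
      (\<Sum>(a, \<kappa>, \<kappa>') \<in> Sigma {a. a \<subseteq># m} (\<lambda>a. ?C A a \<times> ?C B (m - a)). F \<kappa> * G \<kappa>')"
    unfolding cs_mult_def content_sum_def sum_product sum.cartesian_product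
    by (subst sum.Sigma)
       (auto simp: finite_submultisets finite_colourings_with_content assms)
  also have "\<dots> = (\<Sum>\<kappa> \<in> ?C (A \<union> B) m. F (restrict \<kappa> A) * G (restrict \<kappa> B))"
  \<comment> \<open>The submultiset \<open>a\<close> is recovered from a colouring as the content of
    its part on \<open>A\<close>.\<close>
  proof (rule sum.reindex_bij_witness[where
        j = "\<lambda>(a, \<kappa>, \<kappa>'). ?join \<kappa> \<kappa>'" and
        i = "\<lambda>\<kappa>. (image_mset \<kappa> (mset_set A), restrict \<kappa> A, restrict \<kappa> B)"], goal_cases)
    case (1 t)
    then show ?case using join by (clarsimp simp: colourings_with_content_def)
  next
    case (2 t)
    then obtain a \<kappa> \<kappa>' where t: "t = (a, \<kappa>, \<kappa>')" and \<kappa>: "\<kappa> \<in> ?C A a" "\<kappa>' \<in> ?C B (m - a)" "a \<subseteq># m"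
      by auto
    then show ?case
      unfolding t prod.case using join[OF \<kappa>(1,2)]
      by (simp only: colourings_with_content_def mem_Collect_eq content_Un) simp
  next
    case (3 \<kappa>)
    then show ?case
      by (auto simp: fun_eq_iff colourings_with_content_def PiE_iff extensional_def)
  next
    case (4 \<kappa>)
    then show ?case
      by (auto simp: colourings_with_content_def restr content_Un)
  next
    case (5 t)
    then show ?case using join by clarsimp
  qed
  finally show "content_sum (A \<union> B) (\<lambda>\<kappa>. F (restrict \<kappa> A) * G (restrict \<kappa> B)) m =
      cs_mult (content_sum A F) (content_sum B G) m"
    by (simp add: content_sum_def)
qed

text \<open>An injective colouring has as content a set \<open>J\<close> of \<open>card B\<close>
  colours, and the colourings with that content are the \<open>(card B)!\<close> bijections onto
  \<open>J\<close>.\<close>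

lemma content_sum_inj_on:
  assumes "finite B"
  shows "content_sum B (\<lambda>\<kappa>. of_bool (inj_on \<kappa> B)) m = fact (card B) * elem_sym (card B) m"
proof (cases "\<exists>J. finite J \<and> J \<subseteq> {0<..} \<and> card J = card B \<and> m = mset_set J")
  case True
  then obtain J where J: "finite J" "J \<subseteq> {0<..}" "card J = card B" "m = mset_set J" by auto
  have "{\<kappa> \<in> colourings_with_content B m. inj_on \<kappa> B} = {\<kappa> \<in> B \<rightarrow>\<^sub>E J. inj_on \<kappa> B}"
  proof (intro equalityI subsetI)
    fix \<kappa> assume \<kappa>: "\<kappa> \<in> {\<kappa> \<in> colourings_with_content B m. inj_on \<kappa> B}"
    then have "mset_set (\<kappa> ` B) = mset_set J"
      using J by (auto simp: colourings_with_content_def image_mset_mset_set)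
    then have "\<kappa> ` B = J"
      using assms J by (simp add: mset_set_eq_iff)
    then show "\<kappa> \<in> {\<kappa> \<in> B \<rightarrow>\<^sub>E J. inj_on \<kappa> B}"
      using \<kappa> by (auto simp: colourings_with_content_def PiE_iff)
  next
    fix \<kappa> assume \<kappa>: "\<kappa> \<in> {\<kappa> \<in> B \<rightarrow>\<^sub>E J. inj_on \<kappa> B}"
    then have "\<kappa> ` B = J"
      using J by (intro card_subset_eq) (auto simp: card_image)
    then show "\<kappa> \<in> {\<kappa> \<in> colourings_with_content B m. inj_on \<kappa> B}"
      using \<kappa> J by (auto simp: colourings_with_content_def PiE_iff image_mset_mset_set)
  qed
  also have "card \<dots> = fact (card B)"
    using assms J by (subst card_inj_on_subset_funcset) (auto simp: fact_prod_rev)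
  finally have "card {\<kappa> \<in> colourings_with_content B m. inj_on \<kappa> B} = fact (card B)" .
  moreover have "elem_sym (card B) m = 1"
    using True by (simp add: elem_sym_def)
  ultimately show ?thesis
    using assms by (simp add: content_sum_of_bool)
next
  case False
  have "{\<kappa> \<in> colourings_with_content B m. inj_on \<kappa> B} = {}"
  proof (rule ccontr)
    assume "\<not> ?thesis"
    then obtain \<kappa> where \<kappa>: "\<kappa> \<in> colourings_with_content B m" "inj_on \<kappa> B" by auto
    then have "m = mset_set (\<kappa> ` B)" "\<kappa> ` B \<subseteq> {0<..}" "card (\<kappa> ` B) = card B"
      by (auto simp: colourings_with_content_def image_mset_mset_set card_image)
    then show False using False assms by blast
  qed
  then have "content_sum B (\<lambda>\<kappa>. of_bool (inj_on \<kappa> B)) m = 0"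
    using assms by (simp only: content_sum_of_bool) simp
  moreover have "elem_sym (card B) m = 0"
    using False by (simp add: elem_sym_def)
  ultimately show ?thesis by simp
qed

text \<open>By induction over the blocks: \<open>e_ind\<close> factors over them, and each block
  \<open>B\<close> contributes a factorial times one elementary symmetric function.\<close>

lemma content_sum_e_ind:
  fixes A :: "'a set"
  assumes "finite A" "partition_on A \<pi>"
  defines "p \<equiv> image_mset card (mset_set \<pi>)"
  shows "content_sum A (e_ind \<pi>) m = prod_mset (image_mset fact p) * elem_sym_part p m"
proof -
  have "finite \<pi>" using assms(1,2) by (rule finite_elements)
  moreover have "disjoint \<pi>" "finite (\<Union>\<pi>)"
    using assms by (auto simp: partition_on_def)
  ultimately have "content_sum (\<Union>\<pi>) (e_ind \<pi>) m =
    prod_mset (image_mset fact (image_mset card (mset_set \<pi>))) *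
      elem_sym_part (image_mset card (mset_set \<pi>)) m"
  proof (induction \<pi> arbitrary: m rule: finite_induct)
    case empty
    have "content_sum {} (e_ind ({} :: 'a set set)) m = content_sum {} (\<lambda>\<kappa>. of_bool (inj_on \<kappa> ({} :: 'a set))) m"
      unfolding content_sum_def e_ind_def by simp
    also have "\<dots> = elem_sym 0 m"
      by (subst content_sum_inj_on) auto
    also have "\<dots> = cs_one m"
    proof -
      have "J = {}" if "finite J" "card J = 0" for J :: "nat set"
        using that by simp
      then have "(\<exists>J. finite J \<and> J \<subseteq> {0<..} \<and> card J = 0 \<and> m = mset_set J) \<longleftrightarrow> m = {#}"
        by (metis card.empty empty_subsetI finite.emptyI mset_set.empty)
      then show ?thesis by (simp only: elem_sym_def cs_one_def)
    qed
    finally show ?case by simp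
  next
    case (insert B \<pi>)
    have disj: "B \<inter> \<Union>\<pi> = {}"
      using insert.hyps insert.prems unfolding pairwise_insert disjnt_def by blast
    have "e_ind (insert B \<pi>) = (\<lambda>\<kappa> :: 'a \<Rightarrow> nat. of_bool (inj_on (restrict \<kappa> B) B) * e_ind \<pi> (restrict \<kappa> (\<Union>\<pi>)))"
    proof
      fix \<kappa> :: "'a \<Rightarrow> nat"
      have "inj_on (restrict \<kappa> (\<Union>\<pi>)) S \<longleftrightarrow> inj_on \<kappa> S" if "S \<in> \<pi>" for S
        using that by (intro inj_on_cong) auto
      moreover have "inj_on (restrict \<kappa> B) B \<longleftrightarrow> inj_on \<kappa> B"
        by (intro inj_on_cong) auto
      ultimately show "e_ind (insert B \<pi>) \<kappa> =
          of_bool (inj_on (restrict \<kappa> B) B) * e_ind \<pi> (restrict \<kappa> (\<Union>\<pi>))"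
        unfolding e_ind_def by simp
    qed
    then have "content_sum (\<Union>(insert B \<pi>)) (e_ind (insert B \<pi>)) m =
        cs_mult (content_sum B (\<lambda>\<kappa>. of_bool (inj_on \<kappa> B))) (content_sum (\<Union>\<pi>) (e_ind \<pi>)) m"
      using insert.prems disj content_sum_Un_disjoint[of B "\<Union>\<pi>" "\<lambda>\<kappa>. of_bool (inj_on \<kappa> B)" "e_ind \<pi>"]
      by simp
    also have "\<dots> = prod_mset (image_mset fact (image_mset card (mset_set (insert B \<pi>)))) *
        cs_mult (elem_sym (card B)) (elem_sym_part (image_mset card (mset_set \<pi>))) m"
    proof -
      have "content_sum (\<Union>\<pi>) (e_ind \<pi>) m' =
          prod_mset (image_mset fact (image_mset card (mset_set \<pi>))) *
            elem_sym_part (image_mset card (mset_set \<pi>)) m'" for m'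
        using insert.prems by (intro insert.IH) (simp_all add: pairwise_insert)
      then show ?thesis
        using insert.hyps insert.prems
        by (simp add: cs_mult_def content_sum_inj_on sum_distrib_left mult_ac)
    qed
    finally show ?case using insert.hyps by simp
  qed
  then show ?thesis using assms by (simp add: partition_on_def)
qed

section \<open>Relabelling of vertices\<close>

text \<open>Composition with \<open>\<phi>\<close> is a content-preserving bijection of proper
  colourings. As edges lie in \<open>V\<close>, injectivity on \<open>V\<close> ensures that an edge
  of the image comes from an edge of the graph.\<close>

lemma chromatic_sym_image:
  assumes "inj_on \<phi> V" "finite V" "\<And>e. e \<in> E \<Longrightarrow> e \<subseteq> V"
  shows "chromatic_sym (\<phi> ` V) ((\<lambda>e. \<phi> ` e) ` E) = chromatic_sym V E"
proof
  fix m
  let ?E = "(\<lambda>e. \<phi> ` e) ` E"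
  let ?\<psi> = "the_inv_into V \<phi>"
  have edge: "{\<phi> u, \<phi> w} \<in> ?E \<longleftrightarrow> {u, w} \<in> E" if "u \<in> V" "w \<in> V" for u w
  proof
    assume "{\<phi> u, \<phi> w} \<in> ?E"
    then obtain e where e: "e \<in> E" "\<phi> ` {u, w} = \<phi> ` e" by auto
    then have "{u, w} = e"
      using inj_on_image_eq_iff[OF assms(1), of "{u, w}" e] assms(3) that by auto
    then show "{u, w} \<in> E" using e by simp
  next
    assume "{u, w} \<in> E"
    then have "\<phi> ` {u, w} \<in> ?E" by (rule imageI)
    then show "{\<phi> u, \<phi> w} \<in> ?E" by simp
  qed
  have inv: "?\<psi> (\<phi> u) = u" if "u \<in> V" for u
    using assms(1) that by (rule the_inv_into_f_f)
  have content: "image_mset \<kappa> (mset_set (\<phi> ` V)) = image_mset (restrict (\<kappa> \<circ> \<phi>) V) (mset_set V)"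
    for \<kappa> :: "_ \<Rightarrow> nat"
  proof -
    have "image_mset \<kappa> (mset_set (\<phi> ` V)) = image_mset (\<kappa> \<circ> \<phi>) (mset_set V)"
      using assms(1) by (simp flip: image_mset_mset_set add: multiset.map_comp)
    also have "\<dots> = image_mset (restrict (\<kappa> \<circ> \<phi>) V) (mset_set V)"
      using assms(2) by (intro image_mset_cong) simp
    finally show ?thesis .
  qed
  have "bij_betw (\<lambda>\<kappa>. restrict (\<kappa> \<circ> \<phi>) V)
      {\<kappa> \<in> proper_colourings (\<phi> ` V) ?E. image_mset \<kappa> (mset_set (\<phi> ` V)) = m}
      {\<kappa> \<in> proper_colourings V E. image_mset \<kappa> (mset_set V) = m}"
  proof (rule bij_betw_byWitness[where f' = "\<lambda>\<kappa>. restrict (\<kappa> \<circ> ?\<psi>) (\<phi> ` V)"], goal_cases)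
    case 1
    show ?case
      by (auto simp: fun_eq_iff inv proper_colourings_def PiE_iff extensional_def)
  next
    case 2
    show ?case
      by (auto simp: fun_eq_iff inv proper_colourings_def PiE_iff extensional_def)
  next
    case 3
    show ?case
      unfolding content using edge by (auto simp: proper_colourings_def PiE_iff)
  next
    case 4
    have "restrict (restrict (\<kappa> \<circ> ?\<psi>) (\<phi> ` V) \<circ> \<phi>) V = restrict \<kappa> V" for \<kappa> :: "_ \<Rightarrow> nat"
      by (auto simp: fun_eq_iff inv)
    moreover have "restrict \<kappa> V = \<kappa>" if "\<kappa> \<in> proper_colourings V E" for \<kappa>
      using that by (simp add: proper_colourings_def PiE_iff extensional_restrict)
    ultimately show ?case
      unfolding content using edge by (auto simp: inv proper_colourings_def PiE_iff)
  qed
  then show "chromatic_sym (\<phi> ` V) ?E m = chromatic_sym V E m"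
    unfolding chromatic_sym_def by (simp add: bij_betw_same_card)
qed

subsection \<open>Words with a fresh last letter\<close>

text \<open>Series of degree \<open>d\<close> are compared word by word: either the word lists the
  values of a colouring, or it has coefficient 0 in \<open>nc_elem\<close> and
  \<open>nc_chromatic\<close>.\<close>

lemma word_cases:
  obtains \<kappa> where "\<kappa> \<in> {1..d} \<rightarrow>\<^sub>E {0<..}" "w = map \<kappa> [1..<d + 1]"
  | "\<not> (length w = d \<and> set w \<subseteq> {0<..})"
proof (cases "length w = d \<and> set w \<subseteq> {0<..}")
  case True
  \<comment> \<open>Position \<open>j\<close> of the mathematics is list index
    \<open>j - 1\<close>.\<close>
  let ?\<kappa> = "\<lambda>j\<in>{1..d}. w ! (j - 1)"
  have "w = map ?\<kappa> [1..<d + 1]"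
    using True by (intro nth_equalityI) (auto simp del: upt_Suc)
  moreover have "?\<kappa> \<in> {1..d} \<rightarrow>\<^sub>E {0<..}"
    using True by (intro PiE_I) (use True in \<open>auto simp: subset_iff\<close>)
  ultimately show ?thesis by (rule that(1)[rotated])
qed (rule that(2))

lemma block_eqI:
  assumes "disjoint \<pi>" "B \<in> \<pi>" "i \<in> B"
  shows "block \<pi> i = B"
  unfolding block_def
proof (rule the_equality)
  show "C = B" if "C \<in> \<pi> \<and> i \<in> C" for C
    using that assms unfolding disjoint_def by blast
qed (use assms in simp)

text \<open>Positions share a block exactly if their \<open>block\<close> values agree, so the
  pairwise condition amounts to injectivity on every block.\<close>

lemma nc_elem_map:
  assumes "partition_on {1..d} \<pi>" "\<kappa> \<in> {1..d} \<rightarrow>\<^sub>E {0<..}"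
  shows "nc_elem d \<pi> (map \<kappa> [1..<d + 1]) = e_ind \<pi> \<kappa>"
proof -
  have disj: "disjoint \<pi>" and un: "\<Union>\<pi> = {1..d}"
    using assms(1) by (auto simp: partition_on_def)
  have "(\<forall>j\<in>{1..d}. \<forall>k\<in>{1..d}. j \<noteq> k \<and> block \<pi> j = block \<pi> k \<longrightarrow> \<kappa> j \<noteq> \<kappa> k) \<longleftrightarrow>
      (\<forall>B\<in>\<pi>. inj_on \<kappa> B)"
  proof
    assume l: "\<forall>j\<in>{1..d}. \<forall>k\<in>{1..d}. j \<noteq> k \<and> block \<pi> j = block \<pi> k \<longrightarrow> \<kappa> j \<noteq> \<kappa> k"
    show "\<forall>B\<in>\<pi>. inj_on \<kappa> B"
    proof (intro ballI inj_onI)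
      fix B j k assume B: "B \<in> \<pi>" "j \<in> B" "k \<in> B" "\<kappa> j = \<kappa> k"
      then have "j \<in> {1..d}" "k \<in> {1..d}" using un by blast+
      moreover have "block \<pi> j = block \<pi> k"
        using B by (simp add: block_eqI[OF disj])
      ultimately show "j = k" using l B(4) by blast
    qed
  next
    assume r: "\<forall>B\<in>\<pi>. inj_on \<kappa> B"
    show "\<forall>j\<in>{1..d}. \<forall>k\<in>{1..d}. j \<noteq> k \<and> block \<pi> j = block \<pi> k \<longrightarrow> \<kappa> j \<noteq> \<kappa> k"
    proof (intro ballI impI)
      fix j k assume jk: "j \<in> {1..d}" "k \<in> {1..d}" "j \<noteq> k \<and> block \<pi> j = block \<pi> k"
      obtain B C where "B \<in> \<pi>" "j \<in> B" "C \<in> \<pi>" "k \<in> C" using jk(1,2) un by blast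
      moreover from this have "B = C" using jk(3) by (simp add: block_eqI[OF disj])
      ultimately show "\<kappa> j \<noteq> \<kappa> k" using r jk(3) by (meson inj_onD)
    qed
  qed
  moreover have "map \<kappa> [1..<d + 1] ! (j - 1) = \<kappa> j" if "j \<in> {1..d}" for j
    using that by (auto simp del: upt_Suc)
  moreover have "set (map \<kappa> [1..<d + 1]) \<subseteq> {0<..}"
    using assms(2) by (auto simp: PiE_iff)
  ultimately show ?thesis
    unfolding nc_elem_def e_ind_def by (simp del: upt_Suc)
qed

text \<open>A word determines its extensional colouring, so the count is 0 or 1.\<close>

lemma nc_chromatic_map:
  assumes "\<kappa> \<in> {1..d} \<rightarrow>\<^sub>E {0<..}"
  shows "nc_chromatic d E (map \<kappa> [1..<d + 1]) = of_bool (\<kappa> \<in> proper_colourings {1..d} E)"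
proof -
  have "\<kappa>' = \<kappa>" if \<kappa>': "\<kappa>' \<in> proper_colourings {1..d} E" "map \<kappa>' [1..<d + 1] = map \<kappa> [1..<d + 1]" for \<kappa>'
  proof (rule PiE_ext[OF _ assms])
    show "\<kappa>' \<in> {1..d} \<rightarrow>\<^sub>E {0<..}" using \<kappa>'(1) by (simp add: proper_colourings_def)
    fix j assume "j \<in> {1..d}"
    then show "\<kappa>' j = \<kappa> j" using \<kappa>'(2) by (simp del: upt_Suc)
  qed
  then have "{\<kappa>' \<in> proper_colourings {1..d} E. map \<kappa>' [1..<d + 1] = map \<kappa> [1..<d + 1]} =
      (if \<kappa> \<in> proper_colourings {1..d} E then {\<kappa>} else {})"
    by (cases "\<kappa> \<in> proper_colourings {1..d} E"; simp only: if_True if_False; blast)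
  then show ?thesis unfolding nc_chromatic_def by simp
qed

text \<open>Properness is a system of inequations along the edges, hence in the span by
  deletion--contraction started with no equations. This guarantees that the choice in
  \<open>nc_coords\<close> succeeds.\<close>

lemma nc_chromatic_expansion:
  "\<exists>c. (\<forall>\<pi>. c \<pi> \<noteq> 0 \<longrightarrow> partition_on {1..d} \<pi>) \<and>
     nc_chromatic d E = (\<lambda>w. \<Sum>\<pi> | partition_on {1..d} \<pi>. c \<pi> * nc_elem d \<pi> w)"
proof -
  let ?D = "{(j, k) \<in> {1..d} \<times> {1..d}. {j, k} \<in> E}"
  have "finite ?D" by (rule finite_subset[of _ "{1..d} \<times> {1..d}"]) auto
  then have "(\<lambda>\<kappa> :: nat \<Rightarrow> nat. of_bool ((\<forall>(j, k)\<in>{}. \<kappa> j = \<kappa> k) \<and> (\<forall>(j, k)\<in>?D. \<kappa> j \<noteq> \<kappa> k))) \<in> e_span {1..d}"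
    by (intro of_bool_eqs_neqs_in_e_span) auto
  then obtain c where c: "(\<lambda>\<kappa> :: nat \<Rightarrow> nat. of_bool ((\<forall>(j, k)\<in>{}. \<kappa> j = \<kappa> k) \<and> (\<forall>(j, k)\<in>?D. \<kappa> j \<noteq> \<kappa> k))) =
      (\<lambda>\<kappa>. \<Sum>\<pi> | partition_on {1..d} \<pi>. c \<pi> * e_ind \<pi> \<kappa>)"
    by (rule e_spanE)
  \<comment> \<open>\<open>nc_coords\<close> asks for coefficients that vanish off the partitions,
    so \<open>c\<close> is cut off there.\<close>
  define c' where "c' \<pi> = (if partition_on {1..d} \<pi> then c \<pi> else 0)" for \<pi>
  have "nc_chromatic d E w = (\<Sum>\<pi> | partition_on {1..d} \<pi>. c' \<pi> * nc_elem d \<pi> w)" for w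
  proof (cases rule: word_cases[where d = d and w = w])
    case (1 \<kappa>)
    have "nc_chromatic d E w = of_bool (\<forall>(j, k)\<in>?D. \<kappa> j \<noteq> \<kappa> k)"
      unfolding 1(2) nc_chromatic_map[OF 1(1)] using 1(1)
      unfolding proper_colourings_def by fastforce
    also have "\<dots> = (\<Sum>\<pi> | partition_on {1..d} \<pi>. c \<pi> * e_ind \<pi> \<kappa>)"
      using fun_cong[OF c, of \<kappa>] by simp
    also have "\<dots> = (\<Sum>\<pi> | partition_on {1..d} \<pi>. c' \<pi> * nc_elem d \<pi> w)"
      unfolding 1(2) using nc_elem_map[OF _ 1(1)]
      by (intro sum.cong refl) (simp add: c'_def del: upt_Suc)
    finally show ?thesis .
  next
    case 2
    have "nc_elem d \<pi> w = 0" for \<pi>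
      using 2 unfolding nc_elem_def by auto
    moreover have "{\<kappa> \<in> proper_colourings {1..d} E. map \<kappa> [1..<d + 1] = w} = {}"
      using 2 by (auto simp: proper_colourings_def PiE_iff simp del: upt_Suc)
    ultimately show ?thesis unfolding nc_chromatic_def by (simp only:) simp
  qed
  moreover have "\<forall>\<pi>. c' \<pi> \<noteq> 0 \<longrightarrow> partition_on {1..d} \<pi>" by (simp add: c'_def)
  ultimately show ?thesis by (intro exI[of _ c'] conjI ext)
qed

lemma nc_chromatic_eq_sum_nc_coords:
  "nc_chromatic d E w =
     (\<Sum>\<pi> | partition_on {1..d} \<pi>. nc_coords d (nc_chromatic d E) \<pi> * nc_elem d \<pi> w)"
  using fun_cong[OF conjunct2[OF someI_ex[OF nc_chromatic_expansion[of d E]]], of w]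
  unfolding nc_coords_def .

section \<open>Deleting a point from a set partition\<close>

text \<open>In a partition the empty set arises only from the block \<open>{x}\<close>; it is
  dropped so that the result is again a partition.\<close>

definition delete_point :: "'a \<Rightarrow> 'a set set \<Rightarrow> 'a set set" where
  "delete_point x \<pi> = (\<lambda>B. B - {x}) ` \<pi> - {{}}"

text \<open>The type of \<open>delete_point d \<pi>\<close> as a function of the type of \<open>\<pi>\<close>.\<close>

definition shrink_type :: "nat multiset \<times> nat \<Rightarrow> nat multiset" where
  "shrink_type t = (if snd t \<le> 1 then fst t else add_mset (snd t - 1) (fst t))"

lemma delete_point_insert:
  assumes "disjoint (insert B \<pi>)" "{} \<notin> \<pi>" "B \<notin> \<pi>" "x \<in> B"
  shows "delete_point x (insert B \<pi>) = (if B = {x} then \<pi> else insert (B - {x}) \<pi>)"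
proof -
  have "x \<notin> C" if "C \<in> \<pi>" for C
    using assms that unfolding pairwise_insert disjnt_def by blast
  then have "(\<lambda>B. B - {x}) ` \<pi> = \<pi>" by (auto simp: image_iff)
  then show ?thesis using assms(2,4) unfolding delete_point_def by auto
qed

lemma partition_on_delete_point:
  assumes "partition_on A \<pi>"
  shows "partition_on (A - {x}) (delete_point x \<pi>)"
proof -
  have "(\<inter>) (A - {x}) ` \<pi> = (\<lambda>B. B - {x}) ` \<pi>"
    using assms by (intro image_cong) (auto simp: partition_on_def)
  then show ?thesis
    using partition_on_restrict[OF assms, of "A - {x}"] by (simp add: delete_point_def Int_absorb2)
qed

text \<open>The block of \<open>d\<close> loses one element, or disappears if it was a singleton.
  The commutative image therefore depends on \<open>\<pi>\<close> only through its type, which later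
  permits collecting terms by type.\<close>

lemma content_sum_delete_point:
  assumes "partition_on {1..d} \<pi>" "d \<ge> 1"
  defines "p \<equiv> shrink_type (part_type d \<pi>)"
  shows "content_sum ({1..d} - {d}) (e_ind (delete_point d \<pi>)) m =
    prod_mset (image_mset fact p) * elem_sym_part p m"
    and "0 \<notin># p"
proof -
  have \<pi>: "disjoint \<pi>" "\<Union>\<pi> = {1..d}" "{} \<notin> \<pi>" "finite \<pi>"
    using assms(1) finite_elements[OF _ assms(1)] by (auto simp: partition_on_def)
  then obtain B where B: "B \<in> \<pi>" "d \<in> B" using assms(2) by (metis UnionE atLeastAtMost_iff order_refl)
  have finB: "finite C" if "C \<in> \<pi>" for C
    using that \<pi>(2) by (metis Sup_upper finite_atLeastAtMost finite_subset)
  have block: "block \<pi> d = B" using B \<pi>(1) by (rule block_eqI[rotated])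
  define \<rho> where "\<rho> = \<pi> - {B}"
  have ins: "\<pi> = insert B \<rho>" "B \<notin> \<rho>" and \<rho>: "finite \<rho>" "{} \<notin> \<rho>" using B \<pi> by (auto simp: \<rho>_def)
  have del: "delete_point d \<pi> = (if B = {d} then \<rho> else insert (B - {d}) \<rho>)"
    using delete_point_insert[of B \<rho> d] \<pi>(1) \<rho>(2) ins(2) B(2) unfolding ins(1) by blast
  \<comment> \<open>If the shrunken block were already present, inserting it would lose a part in
    the multiset of block sizes.\<close>
  have new: "B - {d} \<notin> \<rho>" if "B \<noteq> {d}"
  proof
    assume C: "B - {d} \<in> \<rho>"
    then have "B - {d} \<in> \<pi>" unfolding \<rho>_def by (rule DiffD1)
    moreover have "B - {d} \<noteq> B" using B(2) by blast
    ultimately have "(B - {d}) \<inter> B = {}" by (intro disjointD[OF \<pi>(1)] B(1))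
    then have "B - {d} = {}" by blast
    then have "{} \<in> \<rho>" using C by (simp only:)
    then show False using \<rho>(2) by simp
  qed
  have t: "part_type d \<pi> = (image_mset card (mset_set \<rho>), card B)"
    by (simp add: part_type_def block \<rho>_def)
  \<comment> \<open>Matches the numerical case distinction of \<open>shrink_type\<close> with the
    one on blocks.\<close>
  have cB: "card B \<le> 1 \<longleftrightarrow> B = {d}"
    using B(2) finB[OF B(1)] by (auto simp: card_le_Suc0_iff_eq)
  have p: "p = image_mset card (mset_set (delete_point d \<pi>))"
    unfolding p_def shrink_type_def t del fst_conv snd_conv cB
    using new \<rho>(1) B(2) finB[OF B(1)] by simp
  have part: "partition_on ({1..d} - {d}) (delete_point d \<pi>)"
    using assms(1) by (rule partition_on_delete_point)
  show "content_sum ({1..d} - {d}) (e_ind (delete_point d \<pi>)) m =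
      prod_mset (image_mset fact p) * elem_sym_part p m"
    unfolding p by (intro content_sum_e_ind part) simp
  show "0 \<notin># p"
  proof
    assume "0 \<in># p"
    moreover have fin: "finite (delete_point d \<pi>)" using part by (intro finite_elements[of "{1..d} - {d}"]) auto
    ultimately obtain C where C: "C \<in> delete_point d \<pi>" "card C = 0" unfolding p by auto
    then have "C \<subseteq> {1..d} - {d}" "C \<noteq> {}" using part unfolding partition_on_def by auto
    then show False using C(2) finite_subset[of C "{1..d} - {d}"] by auto
  qed
qed

text \<open>A colour used nowhere else cannot spoil injectivity, so each block is tested only on
  \<open>B - {x}\<close>. An empty remainder imposes no condition and may be dropped.\<close>

lemma e_ind_fresh_colour:
  assumes "\<Union>\<pi> = insert x A" "j \<notin> \<kappa> ` A"
  shows "e_ind \<pi> (\<kappa>(x := j)) = e_ind (delete_point x \<pi>) \<kappa>"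
proof -
  have "inj_on (\<kappa>(x := j)) B \<longleftrightarrow> inj_on \<kappa> (B - {x})" if "B \<in> \<pi>" for B
  proof -
    have sub: "B - {x} \<subseteq> A" using assms(1) that by blast
    have upd: "inj_on (\<kappa>(x := j)) (B - {x}) \<longleftrightarrow> inj_on \<kappa> (B - {x})"
      by (intro inj_on_cong) auto
    have notin: "j \<notin> (\<kappa>(x := j)) ` (B - {x})" using sub assms(2) by auto
    show ?thesis
    proof (cases "x \<in> B")
      case True
      then have eq: "inj_on (\<kappa>(x := j)) B \<longleftrightarrow> inj_on (\<kappa>(x := j)) (insert x (B - {x}))"
        by (simp add: insert_absorb)
      show ?thesis
        unfolding eq inj_on_insert using notin upd by simp
    qed (use upd in simp)
  qed
  then have "(\<forall>B\<in>\<pi>. inj_on (\<kappa>(x := j)) B) \<longleftrightarrow> (\<forall>B\<in>delete_point x \<pi>. inj_on \<kappa> B)"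
    unfolding delete_point_def by auto
  then show ?thesis by (simp add: e_ind_def)
qed

text \<open>A fresh colour at \<open>x\<close> satisfies every edge at \<open>x\<close>, leaving the
  edges that avoid \<open>x\<close>. A loop must be excluded because
  \<open>proper_colourings\<close> also tests \<open>u = w\<close>.\<close>

lemma proper_colourings_fresh_colour:
  assumes "\<kappa> \<in> A \<rightarrow>\<^sub>E {0<..}" "x \<notin> A" "j > 0" "j \<notin> \<kappa> ` A" "{x} \<notin> E"
  shows "\<kappa>(x := j) \<in> proper_colourings (insert x A) E \<longleftrightarrow> \<kappa> \<in> proper_colourings A {e \<in> E. x \<notin> e}"
proof -
  have "\<kappa>(x := j) \<in> insert x A \<rightarrow>\<^sub>E {0<..}"
    using assms(1,3) by (auto simp: PiE_iff extensional_def)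
  moreover have "(\<forall>u\<in>insert x A. \<forall>w\<in>insert x A. {u, w} \<in> E \<longrightarrow> (\<kappa>(x := j)) u \<noteq> (\<kappa>(x := j)) w) \<longleftrightarrow>
      (\<forall>u\<in>A. \<forall>w\<in>A. {u, w} \<in> {e \<in> E. x \<notin> e} \<longrightarrow> \<kappa> u \<noteq> \<kappa> w)" (is "?L \<longleftrightarrow> ?R")
  proof
    assume ?L
    then show ?R using assms(2) by (metis (mono_tags, lifting) fun_upd_other insertCI mem_Collect_eq)
  next
    assume R: ?R
    show ?L
    proof (intro ballI impI)
      fix u w assume uw: "u \<in> insert x A" "w \<in> insert x A" "{u, w} \<in> E"
      have "\<not> (u = x \<and> w = x)" using uw(3) assms(5) by auto
      then consider "u = x" "w \<in> A" "w \<noteq> x" | "w = x" "u \<in> A" "u \<noteq> x" | "u \<in> A" "w \<in> A" "u \<noteq> x" "w \<noteq> x"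
        using uw(1,2) by blast
      then show "(\<kappa>(x := j)) u \<noteq> (\<kappa>(x := j)) w"
      proof cases
        case 3
        then show ?thesis using R uw(3) by simp
      qed (use assms(4) in auto)
    qed
  qed
  ultimately show ?thesis
    using assms(1) unfolding proper_colourings_def by blast
qed

text \<open>Evaluate both sides of \<open>Y\<^sub>G = \<Sum>\<^sub>\<pi> c\<^sub>\<pi> e\<^sub>\<pi>\<close> at words in which vertex \<open>d\<close> has a colour that occurs
  nowhere else.\<close>

lemma chromatic_sym_delete_last:
  fixes E :: "nat set set"
  assumes "d \<ge> 1" "{d} \<notin> E"
  defines "p \<equiv> \<lambda>\<pi>. shrink_type (part_type d \<pi>)"
  shows "chromatic_sym ({1..d} - {d}) {e \<in> E. d \<notin> e} m =
    (\<Sum>\<pi> | partition_on {1..d} \<pi>. nc_coords d (nc_chromatic d E) \<pi> *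
       (prod_mset (image_mset fact (p \<pi>)) * elem_sym_part (p \<pi>) m))"
proof -
  let ?A = "{1..d} - {d}"
  let ?c = "nc_coords d (nc_chromatic d E)"
  have ins: "insert d ?A = {1..d}" using assms(1) by auto
  have "of_bool (\<kappa> \<in> proper_colourings ?A {e \<in> E. d \<notin> e}) =
      (\<Sum>\<pi> | partition_on {1..d} \<pi>. ?c \<pi> * e_ind (delete_point d \<pi>) \<kappa>)"
    if "\<kappa> \<in> colourings_with_content ?A m" for \<kappa>
  proof -
    have \<kappa>: "\<kappa> \<in> ?A \<rightarrow>\<^sub>E {0<..}" using that by (simp add: colourings_with_content_def)
    \<comment> \<open>Avoiding 0 as well makes the fresh colour positive.\<close>
    have "finite (insert 0 (\<kappa> ` ?A))" by simp
    then obtain j where j: "j \<notin> insert 0 (\<kappa> ` ?A)" using ex_new_if_finite infinite_UNIV_nat by blast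
    have ext: "\<kappa>(d := j) \<in> {1..d} \<rightarrow>\<^sub>E {0<..}"
    proof -
      have "\<kappa>(d := j) \<in> insert d ?A \<rightarrow>\<^sub>E {0<..}"
        using \<kappa> j by (auto simp: PiE_iff extensional_def)
      then show ?thesis by (simp only: ins)
    qed
    have "of_bool (\<kappa> \<in> proper_colourings ?A {e \<in> E. d \<notin> e}) =
        (of_bool (\<kappa>(d := j) \<in> proper_colourings {1..d} E) :: rat)"
      using proper_colourings_fresh_colour[of \<kappa> ?A d j E] \<kappa> j assms(2) unfolding ins by simp
    also have "\<dots> = nc_chromatic d E (map (\<kappa>(d := j)) [1..<d + 1])"
      using nc_chromatic_map[OF ext] by simp
    also have "\<dots> = (\<Sum>\<pi> | partition_on {1..d} \<pi>. ?c \<pi> * nc_elem d \<pi> (map (\<kappa>(d := j)) [1..<d + 1]))"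
      by (rule nc_chromatic_eq_sum_nc_coords)
    also have "\<dots> = (\<Sum>\<pi> | partition_on {1..d} \<pi>. ?c \<pi> * e_ind (delete_point d \<pi>) \<kappa>)"
    proof (rule sum.cong)
      fix \<pi> assume "\<pi> \<in> {\<pi>. partition_on {1..d} \<pi>}"
      then have \<pi>: "partition_on {1..d} \<pi>" by simp
      have "e_ind \<pi> (\<kappa>(d := j)) = e_ind (delete_point d \<pi>) \<kappa>"
      proof (rule e_ind_fresh_colour)
        show "\<Union>\<pi> = insert d ?A" using \<pi> ins unfolding partition_on_def by metis
      qed (use j in simp)
      then show "?c \<pi> * nc_elem d \<pi> (map (\<kappa>(d := j)) [1..<d + 1]) =
          ?c \<pi> * e_ind (delete_point d \<pi>) \<kappa>"
        unfolding nc_elem_map[OF \<pi> ext] by simp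
    qed simp
    finally show ?thesis .
  qed
  then have "chromatic_sym ?A {e \<in> E. d \<notin> e} m =
      (\<Sum>\<kappa>\<in>colourings_with_content ?A m.
        \<Sum>\<pi> | partition_on {1..d} \<pi>. ?c \<pi> * e_ind (delete_point d \<pi>) \<kappa>)"
    by (simp only: chromatic_sym_eq_content_sum[OF finite_Diff[OF finite_atLeastAtMost]]
        content_sum_def cong: sum.cong)
  also have "\<dots> = (\<Sum>\<pi> | partition_on {1..d} \<pi>. ?c \<pi> *
      content_sum ?A (e_ind (delete_point d \<pi>)) m)"
    unfolding content_sum_def sum_distrib_left by (rule sum.swap)
  also have "\<dots> = (\<Sum>\<pi> | partition_on {1..d} \<pi>. ?c \<pi> *
      (prod_mset (image_mset fact (p \<pi>)) * elem_sym_part (p \<pi>) m))"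
    unfolding p_def using content_sum_delete_point(1) assms(1) by (intro sum.cong) auto
  finally show ?thesis .
qed

section \<open>Collecting coefficients by type\<close>

text \<open>Indices may share a key and their coefficients may cancel, so the keys of
  \<open>c\<close> can form a proper subset of the image of \<open>k\<close>; the lost keys
  contribute 0.\<close>

lemma sum_keys_sum_single:
  fixes a :: "'i \<Rightarrow> rat" and k :: "'i \<Rightarrow> 'k"
  assumes "finite I"
  defines "c \<equiv> \<Sum>i\<in>I. Poly_Mapping.single (k i) (a i)"
  shows "(\<Sum>p\<in>Poly_Mapping.keys c. Poly_Mapping.lookup c p * F p) = (\<Sum>i\<in>I. a i * F (k i))"
    and "Poly_Mapping.keys c \<subseteq> k ` I"
proof -
  have lookup: "Poly_Mapping.lookup c p = (\<Sum>i\<in>I. if k i = p then a i else 0)" for p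
    unfolding c_def lookup_sum lookup_single when_def by simp
  show keys: "Poly_Mapping.keys c \<subseteq> k ` I"
  proof
    fix p assume "p \<in> Poly_Mapping.keys c"
    then have "(\<Sum>i\<in>I. if k i = p then a i else 0) \<noteq> 0" by (simp add: in_keys_iff lookup)
    then obtain i where "i \<in> I" "(if k i = p then a i else 0) \<noteq> 0" by (rule sum.not_neutral_contains_not_neutral)
    then show "p \<in> k ` I" by (auto split: if_splits)
  qed
  have "(\<Sum>p\<in>Poly_Mapping.keys c. Poly_Mapping.lookup c p * F p) =
      (\<Sum>p\<in>k ` I. Poly_Mapping.lookup c p * F p)"
    using assms(1) keys by (intro sum.mono_neutral_left) (auto simp: in_keys_iff)
  also have "\<dots> = (\<Sum>i\<in>I. \<Sum>p\<in>k ` I. (if k i = p then a i else 0) * F p)"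
    unfolding lookup sum_distrib_right by (rule sum.swap)
  also have "\<dots> = (\<Sum>i\<in>I. a i * F (k i))"
    using assms(1) by (intro sum.cong) (simp_all add: if_distrib[where f = "\<lambda>x. x * _"] cong: if_cong)
  finally show "(\<Sum>p\<in>Poly_Mapping.keys c. Poly_Mapping.lookup c p * F p) = (\<Sum>i\<in>I. a i * F (k i))" .
qed

lemma lookup_nu:
  "Poly_Mapping.lookup (nu d f) t =
    (\<Sum>\<pi> | partition_on {1..d} \<pi> \<and> part_type d \<pi> = t. nc_coords d f \<pi>)"
proof -
  have fin: "finite {\<pi>. partition_on {1..d} \<pi>}" by (simp add: finitely_many_partition_on)
  show ?thesis
    unfolding nu_def lookup_sum lookup_single when_def
    using fin by (subst sum.inter_filter[symmetric]) (auto intro!: sum.cong)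
qed

text \<open>Single coordinates \<open>c\<^sub>\<pi>\<close> may be negative; the hypothesis controls
  only their sums over all partitions of one type. These sums suffice, since the factor belonging to
  \<open>\<pi>\<close> depends on its type alone.\<close>

lemma e_positive_delete_last:
  fixes E :: "nat set set"
  assumes "d \<ge> 1" "{d} \<notin> E" and nonneg: "\<And>t. 0 \<le> Poly_Mapping.lookup (y_labelled d E) t"
  shows "e_positive ({1..d} - {d}) {e \<in> E. d \<notin> e}"
proof -
  let ?\<Pi> = "{\<pi>. partition_on {1..d} \<pi>}"
  let ?y = "Poly_Mapping.lookup (y_labelled d E)"
  let ?h = "\<lambda>t. prod_mset (image_mset fact (shrink_type t)) :: rat"
  define T where "T = part_type d ` ?\<Pi>"
  have fin: "finite ?\<Pi>" by (simp add: finitely_many_partition_on)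
  then have finT: "finite T" by (simp add: T_def)
  \<comment> \<open>Distinct types may shrink to the same partition, as \<open>({#2#}, 1)\<close>
    and \<open>({#}, 3)\<close> do; their contributions are added.\<close>
  define c where "c = (\<Sum>t\<in>T. Poly_Mapping.single (shrink_type t) (?y t * ?h t))"
  have "chromatic_sym ({1..d} - {d}) {e \<in> E. d \<notin> e} m =
      (\<Sum>p\<in>Poly_Mapping.keys c. Poly_Mapping.lookup c p * elem_sym_part p m)" for m
  proof -
    have "chromatic_sym ({1..d} - {d}) {e \<in> E. d \<notin> e} m =
        (\<Sum>\<pi>\<in>?\<Pi>. nc_coords d (nc_chromatic d E) \<pi> *
          (?h (part_type d \<pi>) * elem_sym_part (shrink_type (part_type d \<pi>)) m))"
      using assms(1,2) by (rule chromatic_sym_delete_last)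
    also have "\<dots> = (\<Sum>t\<in>T. \<Sum>\<pi> | \<pi> \<in> ?\<Pi> \<and> part_type d \<pi> = t. nc_coords d (nc_chromatic d E) \<pi> *
          (?h (part_type d \<pi>) * elem_sym_part (shrink_type (part_type d \<pi>)) m))"
      unfolding T_def by (rule sum.image_gen[OF fin])
    also have "\<dots> = (\<Sum>t\<in>T. ?y t * ?h t * elem_sym_part (shrink_type t) m)"
      unfolding y_labelled_def lookup_nu by (intro sum.cong) (simp_all add: sum_distrib_right mult.assoc)
    also have "\<dots> = (\<Sum>p\<in>Poly_Mapping.keys c. Poly_Mapping.lookup c p * elem_sym_part p m)"
      unfolding c_def using finT by (rule sum_keys_sum_single(1)[symmetric])
    finally show ?thesis .
  qed
  moreover have "0 \<notin># p" if "p \<in> Poly_Mapping.keys c" for p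
  proof -
    have "p \<in> shrink_type ` T" using that unfolding c_def by (rule subsetD[OF sum_keys_sum_single(2)[OF finT]])
    then show ?thesis using content_sum_delete_point(2) assms(1) by (auto simp: T_def)
  qed
  moreover have "0 \<le> Poly_Mapping.lookup c p" for p
  proof -
    have "0 \<le> prod_mset (image_mset fact q :: rat multiset)" for q :: "nat multiset"
      by (induction q) auto
    then show ?thesis
      unfolding c_def lookup_sum lookup_single when_def
      using nonneg by (intro sum_nonneg) (auto intro: mult_nonneg_nonneg)
  qed
  ultimately show ?thesis unfolding e_positive_def by (intro exI[of _ c]) auto
qed

section \<open>From labelled graphs to pointed graphs\<close>

lemma ex_labelling_at:
  assumes "finite V" "v \<in> V"
  shows "\<exists>\<phi>. labelling_at V v \<phi>"
proof -
  obtain \<phi> where \<phi>: "bij_betw \<phi> (V - {v}) {1..<card V}"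
    using assms finite_same_card_bij[of "V - {v}" "{1..<card V}"] by auto
  then have "bij_betw (\<phi>(v := card V)) (V - {v}) {1..<card V}"
    by (subst bij_betw_cong[where g = \<phi>]) auto
  then have "bij_betw (\<phi>(v := card V)) (insert v (V - {v})) (insert (card V) {1..<card V})"
    using notIn_Un_bij_betw[of v "V - {v}" "\<phi>(v := card V)" "{1..<card V}"] by simp
  moreover have "insert (card V) {1..<card V} = {1..card V}"
    using assms by (auto simp: card_gt_0_iff Suc_le_eq)
  ultimately show ?thesis
    using assms(2) unfolding labelling_at_def by (intro exI[of _ "\<phi>(v := card V)"]) (simp add: insert_absorb)
qed

theorem theorem6p8:
  fixes V :: "'a set" and E :: "'a set set" and v :: 'a
  assumes "simple_graph V E"
    and "v \<in> V"
    and "e_positive_at V E v"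
  shows "e_positive (V - {v}) {e \<in> E. v \<notin> e}"
proof -
  have finV: "finite V" and edges: "\<And>e. e \<in> E \<Longrightarrow> e \<subseteq> V \<and> card e = 2"
    using assms(1) by (auto simp: simple_graph_def)
  define d where "d = card V"
  \<comment> \<open>This is the labelling chosen in \<open>y_pointed\<close>, so the hypothesis
    speaks of \<open>y_labelled d E'\<close> itself.\<close>
  define \<phi> where "\<phi> = (SOME \<phi>. labelling_at V v \<phi>)"
  define E' where "E' = (\<lambda>e. \<phi> ` e) ` E"
  have "labelling_at V v \<phi>"
    unfolding \<phi>_def using ex_labelling_at[OF finV assms(2)] by (rule someI_ex)
  then have inj: "inj_on \<phi> V" and im: "\<phi> ` V = {1..d}" and \<phi>v: "\<phi> v = d"
    by (auto simp: labelling_at_def bij_betw_def d_def)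
  have "d \<ge> 1" using finV assms(2) by (auto simp: d_def card_gt_0_iff Suc_le_eq)
  \<comment> \<open>Injectivity keeps the two ends of an edge apart, so relabelling creates no
    loop.\<close>
  moreover have "{d} \<notin> E'"
  proof
    assume "{d} \<in> E'"
    then obtain e where e: "e \<in> E" "{d} = \<phi> ` e" by (auto simp: E'_def)
    then have "card (\<phi> ` e) = 2" using edges inj by (metis card_image inj_on_subset)
    then show False using e(2)[symmetric] by simp
  qed
  moreover have "0 \<le> Poly_Mapping.lookup (y_labelled d E') t" for t
    using assms(3) by (cases t) (simp add: e_positive_at_def y_pointed_def d_def E'_def \<phi>_def Let_def)
  ultimately have "e_positive ({1..d} - {d}) {e \<in> E'. d \<notin> e}"
    by (rule e_positive_delete_last)
  moreover have "\<phi> ` (V - {v}) = {1..d} - {d}"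
    using inj_on_image_set_diff[OF inj, of V "{v}"] assms(2) im \<phi>v by simp
  moreover have "{e \<in> E'. d \<notin> e} = (\<lambda>e. \<phi> ` e) ` {e \<in> E. v \<notin> e}"
  proof -
    have "d \<in> \<phi> ` e \<longleftrightarrow> v \<in> e" if "e \<in> E" for e
      using inj_on_image_mem_iff[OF inj assms(2), of e] edges[OF that] \<phi>v by auto
    then show ?thesis by (auto simp: E'_def)
  qed
  \<comment> \<open>\<open>e_positive\<close> depends on a graph only through its chromatic
    symmetric function, so it passes from the labelled copy back to the original.\<close>
  moreover have "chromatic_sym (\<phi> ` (V - {v})) ((\<lambda>e. \<phi> ` e) ` {e \<in> E. v \<notin> e}) =
      chromatic_sym (V - {v}) {e \<in> E. v \<notin> e}"
    using finV edges by (intro chromatic_sym_image inj_on_subset[OF inj]) auto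
  ultimately show ?thesis by (simp add: e_positive_def)
qed

end
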